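(* For every integer $M\ge 1$, each physical mode $k_{\mathrm{FD}^{\mathrm{phys}},2M}$ of the numerical dispersion relation $$\sum_{p=1}^{M} \frac{[(2p-3)!!]^2}{(2p-1)!}\,\sin^{2p-1}\left(\frac{k_{\mathrm{FD},2M}\,h}{2}\right)=\pm\frac12 K,\qquad K=k^{\mathrm{ex}}h,$$ of the spatially semi-discrete staggered finite difference method FD2M satisfies $$k_{\mathrm{FD}^{\mathrm{phys}},2M}=\pm k^{\mathrm{ex}}\left(1+\varsigma_{2M}\right),\qquad \varsigma_{2M}=\frac{[(2M-1)!!]^2}{2^{2M}(2M+1)!}\,K^{2M}+\mathcal{O}(K^{2M+2})\quad\text{as }K\to 0 .$$ In other words, the dispersion error of the FD2M scheme is of order $2M$.
   Context: Model: the one-dimensional dimensionless Maxwell–Lorentz system $\partial_t H=\partial_x E$, $\partial_t D=\partial_x H$, $\partial_t P=J$, $\partial_t J=-2\gamma J-\omega_1^2P+\omega_p^2E$, $D=\epsilon_\infty E+P$, with $\epsilon_s>\epsilon_\infty>0$, $\epsilon_d=\epsilon_s-\epsilon_\infty$, $\omega_1>0$, $\omega_p^2=\epsilon_d\omega_1^2$, $\gamma\ge 0$. The angular frequency $\omega\ge 0$ is real. With $\hat\omega=\omega/\omega_1$, $\hat\gamma=\gamma/\omega_1$ and $\mathbf p=[\epsilon_s,\epsilon_\infty,\hat\gamma]$, the exact wave number (possibly complex) is $$k^{\mathrm{ex}}=\omega\sqrt{\epsilon(\hat\omega;\mathbf p)},\qquad \epsilon(\hat\omega;\mathbf p)=\epsilon_\infty\left(1-\frac{\epsilon_d/\epsilon_\infty}{\hat\omega^2+2i\hat\gamma\hat\omega-1}\right).$$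 FD2M scheme: on a uniform grid of step $h>0$, with $H_{j+1/2}$ on the dual grid $\{(j+\frac12)h\}$ and $E_j,D_j,P_j,J_j$ on the primal grid $\{jh\}$, $j\in\mathbb Z$, the spatial derivatives in the system are replaced by $$(\mathcal D_h^{(2M)}E)_{j+1/2}=\frac1h\sum_{p=1}^M\frac{\lambda^{2M}_{2p-1}}{2p-1}(E_{j+p}-E_{j-p+1}),\qquad (\widetilde{\mathcal D}_h^{(2M)}H)_{j}=\frac1h\sum_{p=1}^M\frac{\lambda^{2M}_{2p-1}}{2p-1}(H_{j+p-1/2}-H_{j-p+1/2}),$$ $$\lambda^{2M}_{2p-1}=\frac{2(-1)^{p-1}[(2M-1)!!]^2}{(2M+2p-2)!!\,(2M-2p)!!\,(2p-1)},$$ while time is kept continuous. Here $n!!$ is the double factorial with $(-1)!!=0!!=1$. Inserting plane waves $X_j(t)=X_0e^{i(k_{\mathrm{FD},2M}jh-\omega t)}$ in all fields and requiring a nontrivial amplitude vector gives the numerical dispersion relation stated in the claim, whose (complex) solutions $k_{\mathrm{FD},2M}$ are the numerical wave numbers. Physical modes: the solutions $k_{\mathrm{FD},2M}$ of the dispersion relation that approximate the exact wave numbers, i.e. for which $k_{\mathrm{FD},2M}=\pm k^{\mathrm{ex}}(1+\mathcal O(K^\tau))$ as $K\to0$ for some $\tau>0$ (one for each sign); all other solutions are called spurious modes. *)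

theory Defs
  imports "HOL-Analysis.Analysis" "HOL-Library.Landau_Symbols"
begin

text \<open>Double factorial on the integers, so that \<open>(-1)!! = 0!! = 1\<close>; the value 1 below \<open>-1\<close> is a
  convention that is never used.\<close>

function dfact :: "int \<Rightarrow> nat" where
  "dfact n = (if n \<le> 0 then 1 else nat n * dfact (n - 2))"
  by pat_completeness auto
termination by (relation "Wellfounded.measure nat") auto

declare dfact.simps [simp del]

text \<open>\<open>fd_coeff M p\<close> is \<open>\<lambda>\<^sup>2\<^sup>M\<close> with lower index \<open>2p-1\<close>, for \<open>1 \<le> p \<le> M\<close>.\<close>

definition fd_coeff :: "nat \<Rightarrow> nat \<Rightarrow> real" where
  "fd_coeff M p =
     2 * (-1) ^ (p - 1) * real (dfact (2 * int M - 1)) ^ 2 /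
     (real (dfact (2 * int M + 2 * int p - 2)) * real (dfact (2 * int M - 2 * int p)) *
      (2 * real p - 1))"

text \<open>Fields on the dual grid are indexed by the left neighbour on the primal grid: \<open>H j\<close> stands for
  the value at \<open>(j + 1/2) h\<close>. Hence \<open>D_primal M h E j\<close> is the difference quotient of \<open>E\<close> at
  \<open>(j + 1/2) h\<close> and \<open>D_dual M h H j\<close> that of \<open>H\<close> at \<open>j h\<close>.\<close>

definition D_primal :: "nat \<Rightarrow> real \<Rightarrow> (int \<Rightarrow> complex) \<Rightarrow> int \<Rightarrow> complex" where
  "D_primal M h E j =
     (1 / of_real h) * (\<Sum>p = 1..M. of_real (fd_coeff M p / (2 * real p - 1)) *
        (E (j + int p) - E (j - int p + 1)))"

definition D_dual :: "nat \<Rightarrow> real \<Rightarrow> (int \<Rightarrow> complex) \<Rightarrow> int \<Rightarrow> complex" where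
  "D_dual M h H j =
     (1 / of_real h) * (\<Sum>p = 1..M. of_real (fd_coeff M p / (2 * real p - 1)) *
        (H (j + int p - 1) - H (j - int p)))"

text \<open>The spatially semi-discrete Maxwell--Lorentz system; the fields take a grid index and a time,
  and \<open>\<omega>\<^sub>p\<^sup>2 = (\<epsilon>\<^sub>s - \<epsilon>\<^sub>i) \<omega>\<^sub>1\<^sup>2\<close>.\<close>

definition fd_solution ::
  "nat \<Rightarrow> real \<Rightarrow> real \<Rightarrow> real \<Rightarrow> real \<Rightarrow> real \<Rightarrow>
   (int \<Rightarrow> real \<Rightarrow> complex) \<Rightarrow> (int \<Rightarrow> real \<Rightarrow> complex) \<Rightarrow> (int \<Rightarrow> real \<Rightarrow> complex) \<Rightarrow>
   (int \<Rightarrow> real \<Rightarrow> complex) \<Rightarrow> (int \<Rightarrow> real \<Rightarrow> complex) \<Rightarrow> bool" where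
  "fd_solution M \<epsilon>\<^sub>s \<epsilon>\<^sub>i \<omega>\<^sub>1 \<gamma> h H E D P J \<longleftrightarrow>
     (\<forall>j t.
        (H j has_vector_derivative D_primal M h (\<lambda>l. E l t) j) (at t) \<and>
        (D j has_vector_derivative D_dual M h (\<lambda>l. H l t) j) (at t) \<and>
        (P j has_vector_derivative J j t) (at t) \<and>
        (J j has_vector_derivative
           (- 2 * of_real \<gamma> * J j t - of_real (\<omega>\<^sub>1 ^ 2) * P j t
            + of_real ((\<epsilon>\<^sub>s - \<epsilon>\<^sub>i) * \<omega>\<^sub>1 ^ 2) * E j t)) (at t) \<and>
        D j t = of_real \<epsilon>\<^sub>i * E j t + P j t)"

definition plane_wave :: "real \<Rightarrow> real \<Rightarrow> complex \<Rightarrow> complex \<Rightarrow> int \<Rightarrow> real \<Rightarrow> complex" where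
  "plane_wave h \<omega> k X0 j t = X0 * exp (\<i> * (k * of_int j * of_real h - of_real (\<omega> * t)))"

definition dual_plane_wave :: "real \<Rightarrow> real \<Rightarrow> complex \<Rightarrow> complex \<Rightarrow> int \<Rightarrow> real \<Rightarrow> complex" where
  "dual_plane_wave h \<omega> k X0 j t =
     X0 * exp (\<i> * (k * (of_int j + 1/2) * of_real h - of_real (\<omega> * t)))"

definition fd_wave_number ::
  "nat \<Rightarrow> real \<Rightarrow> real \<Rightarrow> real \<Rightarrow> real \<Rightarrow> real \<Rightarrow> real \<Rightarrow> complex \<Rightarrow> bool" where
  "fd_wave_number M \<epsilon>\<^sub>s \<epsilon>\<^sub>i \<omega>\<^sub>1 \<gamma> h \<omega> k \<longleftrightarrow>
     (\<exists>H0 E0 D0 P0 J0. (H0, E0, D0, P0, J0) \<noteq> (0, 0, 0, 0, 0) \<and>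
        fd_solution M \<epsilon>\<^sub>s \<epsilon>\<^sub>i \<omega>\<^sub>1 \<gamma> h
          (dual_plane_wave h \<omega> k H0) (plane_wave h \<omega> k E0) (plane_wave h \<omega> k D0)
          (plane_wave h \<omega> k P0) (plane_wave h \<omega> k J0))"

text \<open>The Lorentz permittivity as a function of the scaled quantities \<open>g = \<gamma> / \<omega>\<^sub>1\<close> and \<open>w = \<omega> / \<omega>\<^sub>1\<close>.
  The denominator vanishes only at the undamped resonance \<open>g = 0\<close>, \<open>w = 1\<close>, where the permittivity
  is infinite.\<close>

definition lorentz_denom :: "real \<Rightarrow> real \<Rightarrow> complex" where
  "lorentz_denom g w = of_real w ^ 2 + 2 * \<i> * of_real g * of_real w - 1"

definition permittivity :: "real \<Rightarrow> real \<Rightarrow> real \<Rightarrow> real \<Rightarrow> complex" where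
  "permittivity \<epsilon>\<^sub>s \<epsilon>\<^sub>i g w =
     of_real \<epsilon>\<^sub>i * (1 - of_real ((\<epsilon>\<^sub>s - \<epsilon>\<^sub>i) / \<epsilon>\<^sub>i) / lorentz_denom g w)"

text \<open>The choice of branch of the root is immaterial: all uses are symmetric in \<open>\<plusminus> k_ex\<close>.\<close>

definition k_ex :: "real \<Rightarrow> real \<Rightarrow> real \<Rightarrow> real \<Rightarrow> real \<Rightarrow> complex" where
  "k_ex \<epsilon>\<^sub>s \<epsilon>\<^sub>i \<omega>\<^sub>1 \<gamma> \<omega> = of_real \<omega> * csqrt (permittivity \<epsilon>\<^sub>s \<epsilon>\<^sub>i (\<gamma> / \<omega>\<^sub>1) (\<omega> / \<omega>\<^sub>1))"

text \<open>Here \<open>ke\<close> is the exact and \<open>k\<close> the numerical wave number.\<close>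

definition fd_dispersion :: "nat \<Rightarrow> real \<Rightarrow> complex \<Rightarrow> complex \<Rightarrow> bool" where
  "fd_dispersion M h ke k \<longleftrightarrow>
     (\<exists>\<sigma>\<in>{1, -1}.
        (\<Sum>p = 1..M. of_real (real (dfact (2 * int p - 3)) ^ 2 / fact (2 * p - 1)) *
           sin (k * of_real h / 2) ^ (2 * p - 1)) = \<sigma> * (1/2) * (ke * of_real h))"

text \<open>A mode is a family of wave numbers, one for each value of a parameter \<open>t\<close> on which the grid step
  and the exact wave number may depend (for instance \<open>t = h\<close> at a fixed frequency); the limit
  \<open>K = ke h \<rightarrow> 0\<close> is taken along the filter \<open>F\<close>. The sign of the mode is \<open>\<sigma>\<close>.\<close>

definition physical_mode ::
  "nat \<Rightarrow> 't filter \<Rightarrow> ('t \<Rightarrow> real) \<Rightarrow> ('t \<Rightarrow> complex) \<Rightarrow> complex \<Rightarrow> ('t \<Rightarrow> complex) \<Rightarrow> bool" where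
  "physical_mode M F h ke \<sigma> k \<longleftrightarrow>
     (\<forall>\<^sub>F t in F. fd_dispersion M (h t) (ke t) (k t)) \<and>
     (\<exists>\<tau>>0. \<exists>\<delta>. (\<forall>\<^sub>F t in F. k t = \<sigma> * ke t * (1 + \<delta> t)) \<and>
        (\<lambda>t. norm (\<delta> t)) \<in> O[F](\<lambda>t. norm (ke t * of_real (h t)) powr \<tau>))"

end

theory Submission
  imports Defs
begin

text \<open>
  The left-hand side of the dispersion relation is \<open>T (sin \<theta>)\<close> with \<open>\<theta> = k h / 2\<close>, where \<open>T\<close> is the
  Taylor polynomial of degree \<open>2M - 1\<close> of the arcsine (\<open>arcsin_poly M\<close>). The scheme is accurate because
  \<open>T (sin \<theta>)\<close> is \<open>\<theta>\<close> up to the first omitted Taylor term: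
  \<open>T (sin \<theta>) = \<theta> - c \<theta>\<^sup>2\<^sup>M\<^sup>+\<^sup>1 + O(\<theta>\<^sup>2\<^sup>M\<^sup>+\<^sup>3)\<close> with \<open>c = [(2M-1)!!]\<^sup>2 / (2M+1)!\<close>.

  That this polynomial governs the scheme (\<open>fd_symbol_eq_arcsin_poly\<close>) is an identity between
  \<open>\<Sum>\<^sub>p (\<lambda>\<^sub>2\<^sub>p\<^sub>-\<^sub>1 / (2p-1)) sin ((2p-1) \<theta>)\<close>, the Fourier symbol of the difference operator, and
  \<open>T (sin \<theta>)\<close>. Passing from order \<open>2m\<close> to order \<open>2m + 2\<close> changes the weights exactly by the
  multiple-angle coefficients of the next term \<open>a sin\<^sup>2\<^sup>m\<^sup>+\<^sup>1 \<theta>\<close> of \<open>T (sin \<theta>)\<close>, so the identity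
  telescopes. Plane waves then turn the Maxwell--Lorentz system into linear equations for the five
  amplitudes, and eliminating the amplitudes gives \<open>S\<^sup>2 = - k_ex\<^sup>2\<close> for the symbol
  \<open>S = (2 \<i> / h) T (sin \<theta>)\<close>, which is the dispersion relation.

  The expansion of \<open>T (sin \<theta>)\<close> (\<open>arcsin_poly_sin_bigo\<close>) avoids the complex arcsine. Its second
  derivative in \<open>\<theta>\<close> is \<open>(1 - x\<^sup>2) T'' - x T'\<close> at \<open>x = sin \<theta>\<close>; this operator annihilates the arcsine, and
  applied to the truncated series it leaves a single multiple of \<open>x\<^sup>2\<^sup>M\<^sup>-\<^sup>1\<close>. Integrating twice from
  \<open>0\<close> gives the expansion.

  Finally write \<open>k = \<sigma> k_ex (1 + \<delta>)\<close>, so that \<open>\<theta> = \<sigma> K (1 + \<delta>) / 2\<close> with \<open>\<delta> \<rightarrow> 0\<close>. Since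
  \<open>T (sin \<theta>)\<close> is close to \<open>\<theta>\<close>, the sign in the dispersion relation must be \<open>\<sigma>\<close>, and dividing the relation
  by \<open>K / 2\<close> gives \<open>\<delta> = (c / 2\<^sup>2\<^sup>M) K\<^sup>2\<^sup>M (1 + \<delta>)\<^sup>2\<^sup>M\<^sup>+\<^sup>1 + O(K\<^sup>2\<^sup>M\<^sup>+\<^sup>2)\<close>. This implies first
  \<open>\<delta> = O(K\<^sup>2\<^sup>M)\<close>, and then that the factor \<open>(1 + \<delta>)\<^sup>2\<^sup>M\<^sup>+\<^sup>1\<close> contributes only to the remainder.\<close>

section \<open>Double factorials and arcsine coefficients\<close>

lemma dfact_odd_Suc: "dfact (2 * int (Suc n) - 1) = (2 * n + 1) * dfact (2 * int n - 1)"
proof -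
  have "nat (2 * int (Suc n) - 1) = 2 * n + 1" by simp
  moreover have "2 * int (Suc n) - 1 - 2 = 2 * int n - 1" by simp
  ultimately show ?thesis
    by (subst dfact.simps) simp
qed

lemma dfact_odd_0: "dfact (2 * int 0 - 1) = 1"
  by (simp add: dfact.simps)

lemma dfact_even: "dfact (2 * int n) = 2 ^ n * fact n"
proof (induction n)
  case 0
  show ?case by (simp add: dfact.simps)
next
  case (Suc n)
  have "nat (2 * int (Suc n)) = 2 * Suc n" by simp
  moreover have "2 * int (Suc n) - 2 = 2 * int n" by simp
  ultimately have step: "dfact (2 * int (Suc n)) = 2 * Suc n * dfact (2 * int n)"
    by (subst dfact.simps) simp
  show ?case
    unfolding step Suc.IH power_Suc fact_Suc of_nat_id by (simp only: mult_ac)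
qed

lemma real_dfact_odd_Suc:
  "real (dfact (2 * int (Suc n) - 1)) = (2 * real n + 1) * real (dfact (2 * int n - 1))"
  unfolding dfact_odd_Suc of_nat_mult by simp

text \<open>\<open>arcsin_coeff q\<close> is the coefficient of \<open>x\<^sup>2\<^sup>q\<^sup>+\<^sup>1\<close> in the Taylor series of the arcsine at \<open>0\<close>.\<close>

definition arcsin_coeff :: "nat \<Rightarrow> real" where
  "arcsin_coeff q = real (dfact (2 * int q - 1)) ^ 2 / fact (2 * q + 1)"

definition arcsin_poly :: "nat \<Rightarrow> complex \<Rightarrow> complex" where
  "arcsin_poly M x = (\<Sum>q<M. of_real (arcsin_coeff q) * x ^ (2 * q + 1))"

lemma arcsin_coeff_0: "arcsin_coeff 0 = 1"
  using dfact_odd_0 by (simp add: arcsin_coeff_def)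

lemma arcsin_coeff_pos: "arcsin_coeff q > 0"
proof -
  have "dfact (2 * int q - 1) > 0"
  proof (induction q)
    case 0 then show ?case using dfact_odd_0 by simp
  next
    case (Suc q) then show ?case unfolding dfact_odd_Suc by simp
  qed
  then show ?thesis by (simp add: arcsin_coeff_def)
qed

text \<open>This two-term recurrence expresses that the arcsine solves \<open>(1 - x\<^sup>2) y'' = x y'\<close>.\<close>

lemma arcsin_coeff_Suc:
  "arcsin_coeff (Suc q) * ((2 * real q + 3) * (2 * real q + 2)) = (2 * real q + 1) ^ 2 * arcsin_coeff q"
proof -
  define G where "G = (2 * real q + 3) * (2 * real q + 2)"
  have "(fact (2 * Suc q + 1) :: real) = G * fact (2 * q + 1)"
    by (simp add: algebra_simps G_def)
  then have "arcsin_coeff (Suc q) =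
      ((2 * real q + 1) ^ 2 * real (dfact (2 * int q - 1)) ^ 2) / (G * fact (2 * q + 1))"
    by (simp only: arcsin_coeff_def real_dfact_odd_Suc power_mult_distrib)
  moreover have "G \<noteq> 0"
    by (auto simp: G_def add_nonneg_eq_0_iff)
  ultimately show ?thesis
    unfolding G_def[symmetric] by (simp add: arcsin_coeff_def del: fact_Suc)
qed

section \<open>The Fourier symbol of the difference operators\<close>

text \<open>The binomial expansion of \<open>(2 \<i> sin \<theta>)\<^sup>2\<^sup>m\<^sup>+\<^sup>1 = (z - 1/z)\<^sup>2\<^sup>m\<^sup>+\<^sup>1\<close> with \<open>z = exp (\<i> \<theta>)\<close> has an
  even number of terms; those of the exponents \<open>2p - 1\<close> and \<open>-(2p - 1)\<close> of \<open>z\<close> combine to a sine of the angle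
  \<open>(2p-1) \<theta>\<close>.\<close>

lemma sin_power_odd:
  fixes \<theta> :: complex
  shows "sin \<theta> ^ (2 * m + 1) =
    (\<Sum>p=1..Suc m. of_real ((-1) ^ (p - 1) * real ((2 * m + 1) choose (Suc m - p)) / 4 ^ m) *
       sin ((2 * of_nat p - 1) * \<theta>))"
proof -
  define n where "n = 2 * m + 1"
  define z where "z = exp (\<i> * \<theta>)"
  define w where "w = exp (- (\<i> * \<theta>))"
  have zw: "z * w = 1" by (simp add: z_def w_def flip: exp_add)
  have s: "2 * \<i> * sin \<theta> = z - w"
    by (simp add: sin_exp_eq z_def w_def)
  define t where "t k = of_nat (n choose k) * z ^ k * (- w) ^ (n - k)" for k
  have "(2 * \<i> * sin \<theta>) ^ n = (\<Sum>k\<le>n. t k)"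
    unfolding s t_def using binomial_ring[of z "- w" n] by simp
  also have "{..n} = {..m} \<union> {Suc m..n}" by (auto simp: n_def)
  also have "sum t ({..m} \<union> {Suc m..n}) = sum t {..m} + sum t {Suc m..n}"
    by (rule sum.union_disjoint) auto
  also have "sum t {..m} = (\<Sum>p=1..Suc m. t (Suc m - p))"
    by (rule sum.reindex_bij_witness[of _ "\<lambda>p. Suc m - p" "\<lambda>k. Suc m - k"]) auto
  also have "sum t {Suc m..n} = (\<Sum>p=1..Suc m. t (m + p))"
    by (rule sum.reindex_bij_witness[of _ "\<lambda>p. m + p" "\<lambda>k. k - m"]) (auto simp: n_def)
  also have "(\<Sum>p=1..Suc m. t (Suc m - p)) + (\<Sum>p=1..Suc m. t (m + p)) =
     (\<Sum>p=1..Suc m. of_real ((-1) ^ (Suc m - p) * real (n choose (Suc m - p))) *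
        (2 * \<i> * sin ((2 * of_nat p - 1) * \<theta>)))"
    unfolding sum.distrib[symmetric]
  proof (rule sum.cong[OF refl])
    fix p assume p: "p \<in> {1..Suc m}"
    then obtain a where a: "p = Suc a" "a \<le> m" by (cases p) auto
    define b where "b = m - a"
    have m: "m = a + b" using a by (simp add: b_def)
    have e1: "exp (\<i> * ((2 * of_nat p - 1) * \<theta>)) = z ^ (2 * a + 1)"
      unfolding z_def exp_of_nat_mult[symmetric]
      by (rule arg_cong[of _ _ exp]) (simp add: a algebra_simps)
    have e2: "exp (- (\<i> * ((2 * of_nat p - 1) * \<theta>))) = w ^ (2 * a + 1)"
      unfolding w_def exp_of_nat_mult[symmetric]
      by (rule arg_cong[of _ _ exp]) (simp add: a algebra_simps)
    have s2: "2 * \<i> * sin ((2 * of_nat p - 1) * \<theta>) = z ^ (2 * a + 1) - w ^ (2 * a + 1)"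
      unfolding e1[symmetric] e2[symmetric] by (simp add: sin_exp_eq)
    have c: "n choose (m + p) = n choose b"
    proof -
      have "b \<le> n" "n - b = m + p" by (simp_all add: n_def m a)
      then show ?thesis using binomial_symmetric[of b n] by simp
    qed
    have zwb: "z ^ b * w ^ b = 1"
      using zw by (metis power_mult_distrib power_one)
    have "Suc m - p = b" "n - b = b + (2 * a + 1)" by (simp_all add: n_def m a)
    then have "t (Suc m - p) = of_nat (n choose b) * z ^ b * (- w) ^ (b + (2 * a + 1))"
      unfolding t_def by simp
    also have "\<dots> = - of_nat (n choose b) * (-1) ^ b * (z ^ b * w ^ b) * w ^ (2 * a + 1)"
      unfolding power_minus[of w] power_add by (simp add: algebra_simps)
    finally have t1: "t (Suc m - p) = - of_nat (n choose b) * (-1) ^ b * w ^ (2 * a + 1)"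
      by (simp add: zwb)
    have "m + p = b + (2 * a + 1)" "n - (m + p) = b" by (simp_all add: n_def m a)
    then have "t (m + p) = of_nat (n choose b) * z ^ (b + (2 * a + 1)) * (- w) ^ b"
      unfolding t_def c by simp
    also have "\<dots> = of_nat (n choose b) * (-1) ^ b * (z ^ b * w ^ b) * z ^ (2 * a + 1)"
      unfolding power_minus[of w] power_add by (simp add: algebra_simps)
    finally have t2: "t (m + p) = of_nat (n choose b) * (-1) ^ b * z ^ (2 * a + 1)"
      by (simp add: zwb)
    have "Suc m - p = b" by (simp add: a b_def)
    then show "t (Suc m - p) + t (m + p) = of_real ((-1) ^ (Suc m - p) * real (n choose (Suc m - p))) *
        (2 * \<i> * sin ((2 * of_nat p - 1) * \<theta>))"
      unfolding s2 t1 t2 by (simp add: algebra_simps)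
  qed
  finally have main: "(2 * \<i> * sin \<theta>) ^ n = (\<Sum>p=1..Suc m. of_real ((-1) ^ (Suc m - p) * real (n choose (Suc m - p))) *
        (2 * \<i> * sin ((2 * of_nat p - 1) * \<theta>)))" .
  have "(2 * \<i>) ^ n = 2 * \<i> * ((-1) ^ m * 4 ^ m)"
    by (simp add: n_def power_mult power_mult_distrib) (rule power_minus)
  then have "2 * \<i> * ((-1) ^ m * 4 ^ m * sin \<theta> ^ n) = (2 * \<i> * sin \<theta>) ^ n"
    unfolding power_mult_distrib[of "2 * \<i>"] by (simp only: mult.assoc)
  also have "\<dots> = 2 * \<i> * (\<Sum>p=1..Suc m. of_real ((-1) ^ (Suc m - p) * real (n choose (Suc m - p))) *
        sin ((2 * of_nat p - 1) * \<theta>))"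
    unfolding main sum_distrib_left by (simp only: mult_ac)
  finally have "2 * \<i> * ((-1) ^ m * 4 ^ m * sin \<theta> ^ n) = 2 * \<i> * (\<Sum>p=1..Suc m. of_real ((-1) ^ (Suc m - p) * real (n choose (Suc m - p))) *
        sin ((2 * of_nat p - 1) * \<theta>))" .
  then have A: "(-1) ^ m * 4 ^ m * sin \<theta> ^ n = (\<Sum>p=1..Suc m. of_real ((-1) ^ (Suc m - p) * real (n choose (Suc m - p))) *
        sin ((2 * of_nat p - 1) * \<theta>))"
    by simp
  have "sin \<theta> ^ n = (-1) ^ m / 4 ^ m * ((-1) ^ m * 4 ^ m * sin \<theta> ^ n)"
  proof -
    have "u / f * (u * f * x) = u * u * x" if "f \<noteq> 0" for u f x :: complex
      using that by simp
    moreover have "(-1) ^ m * (-1) ^ m = (1 :: complex)"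
      by (simp flip: power_mult_distrib)
    ultimately show ?thesis by simp
  qed
  also have "\<dots> = (\<Sum>p=1..Suc m. of_real ((-1) ^ (p - 1) * real (n choose (Suc m - p)) / 4 ^ m) *
       sin ((2 * of_nat p - 1) * \<theta>))"
    unfolding A sum_distrib_left
  proof (rule sum.cong[OF refl])
    fix p assume "p \<in> {1..Suc m}"
    then obtain a where a: "p = Suc a" "a \<le> m" by (cases p) auto
    then have "(-1 :: complex) ^ m * (-1) ^ (Suc m - p) = (-1) ^ (p - 1)"
      by (simp add: minus_one_power_iff)
    then show "(-1) ^ m / 4 ^ m * (of_real ((-1) ^ (Suc m - p) * real (n choose (Suc m - p))) *
        sin ((2 * of_nat p - 1) * \<theta>)) = of_real ((-1) ^ (p - 1) * real (n choose (Suc m - p)) / 4 ^ m) *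
       sin ((2 * of_nat p - 1) * \<theta>)"
      by (simp add: field_simps)
  qed
  finally show ?thesis by (simp add: n_def)
qed

definition fd_weight :: "nat \<Rightarrow> nat \<Rightarrow> real" where
  "fd_weight M p = fd_coeff M p / (2 * real p - 1)"

lemma fd_weight_eq:
  assumes "1 \<le> p" "p \<le> M"
  shows "fd_weight M p = (-1) ^ (p - 1) * real (dfact (2 * int M - 1)) ^ 2 /
           (4 ^ (M - 1) * fact (M + p - 1) * fact (M - p) * (2 * real p - 1) ^ 2)"
proof -
  obtain a where a: "p = Suc a" using assms by (cases p) auto
  obtain b where b: "M = p + b" using assms le_Suc_ex by blast
  have "2 * int M + 2 * int p - 2 = 2 * int (M + p - 1)" "2 * int M - 2 * int p = 2 * int (M - p)"
    using assms by auto
  then have d: "dfact (2 * int M + 2 * int p - 2) = 2 ^ (M + p - 1) * fact (M + p - 1)"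
    "dfact (2 * int M - 2 * int p) = 2 ^ (M - p) * fact (M - p)"
    by (simp_all only: dfact_even)
  have pw: "(2::real) ^ (M + p - 1) * 2 ^ (M - p) = 2 * 4 ^ (M - 1)"
  proof -
    have "(2::real) ^ (M + p - 1) * 2 ^ (M - p) = 2 ^ (2 * (M - 1) + 1)"
      unfolding power_add[symmetric] using a b by (intro arg_cong[of _ _ "(^) 2"]) auto
    also have "\<dots> = 2 * 4 ^ (M - 1)" by (simp add: power_mult)
    finally show ?thesis .
  qed
  have "fd_weight M p = 2 * ((-1) ^ (p - 1) * real (dfact (2 * int M - 1)) ^ 2) /
     (((2::real) ^ (M + p - 1) * 2 ^ (M - p)) * (fact (M + p - 1) * fact (M - p) * (2 * real p - 1) ^ 2))"
    unfolding fd_weight_def fd_coeff_def d by (simp add: power2_eq_square mult_ac)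
  also have "\<dots> = (-1) ^ (p - 1) * real (dfact (2 * int M - 1)) ^ 2 /
           (4 ^ (M - 1) * fact (M + p - 1) * fact (M - p) * (2 * real p - 1) ^ 2)"
    unfolding pw by (simp add: mult_ac)
  finally show ?thesis .
qed

lemma fd_weight_top:
  "fd_weight (Suc m) (Suc m) = arcsin_coeff m * ((-1) ^ m / 4 ^ m)"
proof -
  define u where "u = (2 * real m + 1) ^ 2"
  have "u \<noteq> 0" unfolding u_def by (simp add: add_nonneg_eq_0_iff)
  have s: "Suc m + Suc m - 1 = 2 * m + 1" "Suc m - Suc m = 0" "Suc m - 1 = m"
    "2 * real (Suc m) - 1 = 2 * real m + 1" by simp_all
  have "fd_weight (Suc m) (Suc m) = (-1) ^ m * (u * real (dfact (2 * int m - 1)) ^ 2) /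
      (4 ^ m * fact (2 * m + 1) * fact 0 * u)"
    using fd_weight_eq[of "Suc m" "Suc m"]
    unfolding real_dfact_odd_Suc s power_mult_distrib u_def by simp
  then show ?thesis
    using \<open>u \<noteq> 0\<close> by (simp add: arcsin_coeff_def mult_ac del: fact_Suc)
qed

text \<open>After clearing the common factor, this is
  \<open>(2m+1)\<^sup>2 = 4 (m+p) (m-p+1) + (2p-1)\<^sup>2\<close>: the weights of orders \<open>2m\<close> and \<open>2m + 2\<close> have the same form,
  and \<open>(2p-1)\<^sup>2\<close> cancels the square in their denominators, which leaves the multiple-angle
  coefficient of \<open>sin\<^sup>2\<^sup>m\<^sup>+\<^sup>1\<close>.\<close>

lemma fd_weight_step:
  assumes "1 \<le> p" "p \<le> m"
  shows "fd_weight (Suc m) p =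
    fd_weight m p + arcsin_coeff m * ((-1) ^ (p - 1) * real ((2 * m + 1) choose (Suc m - p)) / 4 ^ m)"
proof -
  obtain a where a: "p = Suc a" using assms by (cases p) auto
  obtain b where b: "m = p + b" using assms le_Suc_ex by blast
  have d: "real (dfact (2 * int (Suc m) - 1)) = (2 * real m + 1) * real (dfact (2 * int m - 1))"
    by (rule real_dfact_odd_Suc)
  define D where "D = real (dfact (2 * int m - 1)) ^ 2"
  define s :: real where "s = (-1) ^ a"
  have ch: "real ((2 * m + 1) choose (Suc m - p)) = fact (2 * m + 1) / (fact (b + 1) * fact (m + p))"
  proof -
    have "Suc m - p = b + 1" "b + 1 \<le> 2 * m + 1" "2 * m + 1 - (b + 1) = m + p"
      by (simp_all add: b)
    then show ?thesis
      using binomial_fact[of "b + 1" "2 * m + 1", where 'a = real] by simp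
  qed
  have w1: "fd_weight (Suc m) p = s * ((2 * real m + 1) ^ 2 * D) /
      (4 ^ m * fact (m + p) * fact (b + 1) * (2 * real p - 1) ^ 2)"
  proof -
    have "Suc m - 1 = m" "Suc m + p - 1 = m + p" "Suc m - p = b + 1" "p - 1 = a" "1 \<le> p" "p \<le> Suc m"
      by (simp_all add: b a)
    then show ?thesis
      using fd_weight_eq[of p "Suc m"] unfolding d power_mult_distrib by (simp only: s_def D_def)
  qed
  have "m = Suc (a + b)" by (simp add: a b)
  then have p4: "(4::real) ^ m = 4 * 4 ^ (m - 1)"
    and f1: "(fact (m + p) :: real) = (real m + real p) * fact (m + p - 1)"
    by (simp_all add: a)
  have f2: "(fact (b + 1) :: real) = (real m - real p + 1) * fact b"
    by (simp add: b algebra_simps)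
  have nz: "real m + real p \<noteq> 0" "real m - real p + 1 \<noteq> 0" "2 * real p - 1 \<noteq> 0"
    using assms by auto
  have "fd_weight m p = s * D / (4 ^ (m - 1) * fact (m + p - 1) * fact b * (2 * real p - 1) ^ 2)"
    using assms by (subst fd_weight_eq) (simp_all add: b a D_def s_def)
  also have "\<dots> = s * D * (4 * (real m + real p) * (real m - real p + 1)) /
      (4 ^ m * fact (m + p) * fact (b + 1) * (2 * real p - 1) ^ 2)"
  proof -
    have "N / (Q * F * B * U) = N * (4 * x * y) / (4 * Q * (x * F) * (y * B) * U)"
      if "x \<noteq> 0" "y \<noteq> 0" for N Q F B U x y :: real
      using that by simp
    from this[OF nz(1,2)] show ?thesis unfolding f1 f2 p4 .
  qed
  finally have w2: "fd_weight m p = s * D * (4 * (real m + real p) * (real m - real p + 1)) /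
      (4 ^ m * fact (m + p) * fact (b + 1) * (2 * real p - 1) ^ 2)" .
  have "arcsin_coeff m * ((-1) ^ (p - 1) * real ((2 * m + 1) choose (Suc m - p)) / 4 ^ m) =
      s * D / (4 ^ m * fact (m + p) * fact (b + 1))"
    unfolding ch arcsin_coeff_def by (simp add: D_def s_def a mult_ac del: fact_Suc)
  also have "\<dots> = s * D * (2 * real p - 1) ^ 2 /
      (4 ^ m * fact (m + p) * fact (b + 1) * (2 * real p - 1) ^ 2)"
    using nz by simp
  finally have w3: "arcsin_coeff m * ((-1) ^ (p - 1) * real ((2 * m + 1) choose (Suc m - p)) / 4 ^ m) =
      s * D * (2 * real p - 1) ^ 2 /
      (4 ^ m * fact (m + p) * fact (b + 1) * (2 * real p - 1) ^ 2)" .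
  have "s * ((2 * real m + 1) ^ 2 * D) =
      s * D * (4 * (real m + real p) * (real m - real p + 1)) + s * D * (2 * real p - 1) ^ 2"
    by algebra
  then show ?thesis
    unfolding w1 w2 w3 by (simp only: add_divide_distrib)
qed

text \<open>Induction on the order: the weights change by the multiple-angle coefficients of the term
  that \<open>arcsin_poly\<close> gains.\<close>

lemma fd_symbol_eq_arcsin_poly:
  fixes \<theta> :: complex
  shows "(\<Sum>p=1..M. of_real (fd_weight M p) * sin ((2 * of_nat p - 1) * \<theta>)) = arcsin_poly M (sin \<theta>)"
proof (induction M)
  case 0
  show ?case by (simp add: arcsin_poly_def)
next
  case (Suc m)
  define S where "S p = sin ((2 * of_nat p - 1) * \<theta>)" for p
  define c where "c p = (-1) ^ (p - 1) * real ((2 * m + 1) choose (Suc m - p)) / 4 ^ m" for p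
  \<comment> \<open>The weight of the new outermost difference is entirely due to the new term.\<close>
  have "(\<Sum>p=1..Suc m. of_real (fd_weight (Suc m) p) * S p) =
     (\<Sum>p=1..m. of_real (fd_weight (Suc m) p) * S p) + of_real (fd_weight (Suc m) (Suc m)) * S (Suc m)"
    by simp
  also have "(\<Sum>p=1..m. of_real (fd_weight (Suc m) p) * S p) =
     (\<Sum>p=1..m. of_real (fd_weight m p) * S p + of_real (arcsin_coeff m) * (of_real (c p) * S p))"
    by (rule sum.cong) (auto simp: fd_weight_step c_def algebra_simps)
  also have "fd_weight (Suc m) (Suc m) = arcsin_coeff m * c (Suc m)"
    unfolding fd_weight_top by (simp add: c_def)
  also have "(\<Sum>p=1..m. of_real (fd_weight m p) * S p + of_real (arcsin_coeff m) * (of_real (c p) * S p)) +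
      of_real (arcsin_coeff m * c (Suc m)) * S (Suc m) =
     (\<Sum>p=1..m. of_real (fd_weight m p) * S p) + of_real (arcsin_coeff m) * (\<Sum>p=1..Suc m. of_real (c p) * S p)"
    by (simp add: sum.distrib sum_distrib_left algebra_simps)
  also have "(\<Sum>p=1..Suc m. of_real (c p) * S p) = sin \<theta> ^ (2 * m + 1)"
    unfolding sin_power_odd[of \<theta> m] by (simp only: c_def S_def)
  also have "(\<Sum>p=1..m. of_real (fd_weight m p) * S p) = arcsin_poly m (sin \<theta>)"
    using Suc.IH by (simp add: S_def)
  finally show ?case by (simp add: S_def arcsin_poly_def)
qed

section \<open>The arcsine polynomial at the sine\<close>

text \<open>By the mean value inequality on the disc of radius \<open>norm z\<close>.\<close>

lemma bigo_antiderivative: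
  fixes f f' :: "complex \<Rightarrow> complex"
  assumes deriv: "\<And>z. (f has_field_derivative f' z) (at z)"
    and "f 0 = 0" and "f' \<in> O[nhds 0](\<lambda>z. z ^ n)"
  shows "f \<in> O[nhds 0](\<lambda>z. z ^ Suc n)"
proof -
  from assms(3) obtain C where C: "C > 0" "\<forall>\<^sub>F z in nhds 0. norm (f' z) \<le> C * norm (z ^ n)"
    by (elim landau_o.bigE)
  then obtain r where r: "r > 0" "\<And>z. norm z < r \<Longrightarrow> norm (f' z) \<le> C * norm (z ^ n)"
    unfolding eventually_nhds_metric by auto
  have "norm (f z) \<le> C * norm (z ^ Suc n)" if z: "norm z < r" for z
  proof -
    have "norm (f z - f 0) \<le> (C * norm z ^ n) * norm (z - 0)"
    proof (rule field_differentiable_bound[where S = "cball 0 (norm z)"])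
      fix w assume "w \<in> cball (0 :: complex) (norm z)"
      then have w: "norm w \<le> norm z" by simp
      then have "norm (f' w) \<le> C * norm w ^ n" using r(2)[of w] z by (simp add: norm_power)
      also have "\<dots> \<le> C * norm z ^ n" using w C(1) by (intro mult_left_mono power_mono) auto
      finally show "norm (f' w) \<le> C * norm z ^ n" .
      show "(f has_field_derivative f' w) (at w within cball 0 (norm z))"
        by (rule has_field_derivative_at_within[OF deriv])
    qed auto
    then show ?thesis using \<open>f 0 = 0\<close> by (simp add: norm_mult norm_power mult_ac)
  qed
  with r(1) have "\<forall>\<^sub>F z in nhds 0. norm (f z) \<le> C * norm (z ^ Suc n)"
    unfolding eventually_nhds_metric by auto
  then show ?thesis by (rule landau_o.bigI[OF C(1)])
qed

lemma sin_bigo: "sin \<in> O[nhds 0](\<lambda>z::complex. z)"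
  and sin_minus_id_bigo: "(\<lambda>z::complex. sin z - z) \<in> O[nhds 0](\<lambda>z. z ^ 3)"
proof -
  have "(cos \<longlongrightarrow> cos (0::complex)) (nhds 0)"
    by (intro tendsto_cos filterlim_ident)
  then have "cos \<in> O[nhds 0](\<lambda>z::complex. z ^ 0)"
    by (intro bigoI_tendsto[where c = 1]) auto
  then have 1: "sin \<in> O[nhds 0](\<lambda>z::complex. z ^ 1)"
    using bigo_antiderivative[of sin cos 0, OF DERIV_sin sin_zero] by simp
  then show "sin \<in> O[nhds 0](\<lambda>z::complex. z)" by simp
  have d1: "((\<lambda>z. cos z - 1) has_field_derivative - sin z) (at z)"
    and d2: "((\<lambda>z. sin z - z) has_field_derivative cos z - 1) (at z)" for z :: complex
    by (auto intro!: derivative_eq_intros)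
  have "(\<lambda>z::complex. cos z - 1) \<in> O[nhds 0](\<lambda>z. z ^ Suc 1)"
    using 1 by (intro bigo_antiderivative[OF d1]) simp_all
  then have "(\<lambda>z::complex. sin z - z) \<in> O[nhds 0](\<lambda>z. z ^ Suc (Suc 1))"
    by (intro bigo_antiderivative[OF d2]) simp_all
  then show "(\<lambda>z::complex. sin z - z) \<in> O[nhds 0](\<lambda>z. z ^ 3)" by (simp add: numeral_3_eq_3)
qed

lemma sin_power_minus_power_bigo:
  "(\<lambda>z::complex. sin z ^ n - z ^ n) \<in> O[nhds 0](\<lambda>z. z ^ (n + 2))"
proof (induction n)
  case 0
  show ?case by simp
next
  case (Suc n)
  have "(\<lambda>z::complex. sin z * (sin z ^ n - z ^ n)) \<in> O[nhds 0](\<lambda>z. z * z ^ (n + 2))"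
    by (intro landau_o.big.mult sin_bigo Suc.IH)
  moreover have "(\<lambda>z::complex. (sin z - z) * z ^ n) \<in> O[nhds 0](\<lambda>z. z ^ 3 * z ^ n)"
    by (intro landau_o.big.mult sin_minus_id_bigo landau_o.big_refl)
  ultimately have "(\<lambda>z::complex. sin z * (sin z ^ n - z ^ n) + (sin z - z) * z ^ n)
      \<in> O[nhds 0](\<lambda>z. z ^ (Suc n + 2))"
    by (intro sum_in_bigo) (simp_all add: power_add numeral_3_eq_3 power2_eq_square mult_ac)
  then show ?case by (simp add: algebra_simps)
qed

text \<open>The formal derivatives of \<open>arcsin_poly\<close>. The natural number \<open>2 * q - 1\<close> is truncated for
  \<open>q = 0\<close>, where the factor \<open>2 * q\<close> removes the term.\<close>

definition arcsin_poly' :: "nat \<Rightarrow> complex \<Rightarrow> complex" where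
  "arcsin_poly' M x = (\<Sum>q<M. of_real (arcsin_coeff q) * (of_nat (2 * q + 1) * x ^ (2 * q)))"

definition arcsin_poly'' :: "nat \<Rightarrow> complex \<Rightarrow> complex" where
  "arcsin_poly'' M x =
     (\<Sum>q<M. of_real (arcsin_coeff q) * (of_nat (2 * q + 1) * (of_nat (2 * q) * x ^ (2 * q - 1))))"

lemma arcsin_poly_deriv: "(arcsin_poly M has_field_derivative arcsin_poly' M x) (at x)"
  unfolding arcsin_poly_def[abs_def] arcsin_poly'_def
  by (intro DERIV_sum DERIV_cmult) (rule derivative_eq_intros refl | simp)+

lemma arcsin_poly'_deriv: "(arcsin_poly' M has_field_derivative arcsin_poly'' M x) (at x)"
  unfolding arcsin_poly'_def[abs_def] arcsin_poly''_def
  by (intro DERIV_sum DERIV_cmult) (rule derivative_eq_intros refl | simp)+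

text \<open>The terms telescope by the recurrence of the coefficients, since the full series is
  annihilated; only the contribution of the last coefficient to the top power survives.\<close>

lemma arcsin_poly_ode:
  "(1 - x ^ 2) * arcsin_poly'' (Suc m) x - x * arcsin_poly' (Suc m) x =
     - of_real ((2 * real m + 1) ^ 2 * arcsin_coeff m) * x ^ (2 * m + 1)"
proof (induction m)
  case 0
  show ?case by (simp add: arcsin_poly''_def arcsin_poly'_def arcsin_coeff_0)
next
  case (Suc m)
  define a :: complex where "a = of_real (arcsin_coeff (Suc m))"
  define n :: complex where "n = of_nat m"
  define X where "X = x ^ (2 * m + 1)"
  have rec: "of_real ((2 * real m + 1) ^ 2 * arcsin_coeff m) = a * ((2 * n + 3) * (2 * n + 2))"
    unfolding arcsin_coeff_Suc[symmetric] by (simp add: a_def n_def)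
  have e1: "arcsin_poly'' (Suc (Suc m)) x = arcsin_poly'' (Suc m) x + a * ((2 * n + 3) * ((2 * n + 2) * X))"
    by (simp add: arcsin_poly''_def a_def n_def X_def algebra_simps)
  have e2: "arcsin_poly' (Suc (Suc m)) x = arcsin_poly' (Suc m) x + a * ((2 * n + 3) * (x * X))"
    by (simp add: arcsin_poly'_def a_def n_def X_def algebra_simps power2_eq_square)
  have e3: "of_real ((2 * real (Suc m) + 1) ^ 2 * arcsin_coeff (Suc m)) = (2 * n + 3) ^ 2 * a"
    by (simp add: a_def n_def algebra_simps power2_eq_square)
  have e4: "x ^ (2 * Suc m + 1) = x ^ 2 * X"
    by (simp add: X_def power2_eq_square)
  have "(1 - x ^ 2) * arcsin_poly'' (Suc m) x - x * arcsin_poly' (Suc m) x =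
      - (a * ((2 * n + 3) * (2 * n + 2))) * X"
    using Suc.IH unfolding rec X_def by simp
  then show ?case
    unfolding e1 e2 e3 e4 by algebra
qed

text \<open>The remainder vanishes to first order at \<open>0\<close>, and by \<open>arcsin_poly_ode\<close> its second
  derivative is a multiple of \<open>sin\<^sup>2\<^sup>M\<^sup>-\<^sup>1 z - z\<^sup>2\<^sup>M\<^sup>-\<^sup>1\<close>. The term with \<open>z\<^sup>2\<^sup>M\<^sup>+\<^sup>1\<close> supplies
  the subtracted power, which is the leading term of \<open>sin\<^sup>2\<^sup>M\<^sup>-\<^sup>1 z\<close>.\<close>

lemma arcsin_poly_sin_bigo:
  assumes "M \<ge> 1"
  shows "(\<lambda>z. arcsin_poly M (sin z) - z + of_real (arcsin_coeff M) * z ^ (2 * M + 1))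
           \<in> O[nhds 0](\<lambda>z. z ^ (2 * M + 3))"
proof -
  obtain m where M: "M = Suc m" using assms by (cases M) auto
  define B :: complex where "B = of_real ((2 * real m + 1) ^ 2 * arcsin_coeff m)"
  define a :: complex where "a = of_real (arcsin_coeff M)"
  have aB: "a * (of_nat (2 * M + 1) * of_nat (2 * M)) = B"
    unfolding B_def arcsin_coeff_Suc[symmetric] by (simp add: a_def M algebra_simps)
  define g2 where "g2 z = - B * (sin z ^ (2 * m + 1) - z ^ (2 * m + 1))" for z
  define g1 where "g1 z = arcsin_poly' M (sin z) * cos z - 1 + a * (of_nat (2 * M + 1) * z ^ (2 * M))" for z
  have "g2 \<in> O[nhds 0](\<lambda>z. z ^ (2 * m + 1 + 2))"
    unfolding g2_def using sin_power_minus_power_bigo[of "2 * m + 1"] by (cases "B = 0") simp_all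
  moreover have "(g1 has_field_derivative g2 z) (at z)" for z
  proof -
    have "(g1 has_field_derivative
        (arcsin_poly'' M (sin z) * cos z * cos z + arcsin_poly' M (sin z) * (- sin z) +
          a * (of_nat (2 * M + 1) * (of_nat (2 * M) * z ^ (2 * M - 1))))) (at z)"
      unfolding g1_def[abs_def]
      by (rule derivative_eq_intros DERIV_chain2[OF arcsin_poly'_deriv] refl | simp)+
    also have "arcsin_poly'' M (sin z) * cos z * cos z + arcsin_poly' M (sin z) * (- sin z) =
        (1 - sin z ^ 2) * arcsin_poly'' M (sin z) - sin z * arcsin_poly' M (sin z)"
      unfolding cos_squared_eq[symmetric] by (simp add: power2_eq_square mult_ac del: cos_squared_eq)
    also have "\<dots> = - B * sin z ^ (2 * m + 1)"
      unfolding M arcsin_poly_ode by (simp only: B_def)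
    also have "a * (of_nat (2 * M + 1) * (of_nat (2 * M) * z ^ (2 * M - 1))) = B * z ^ (2 * m + 1)"
      unfolding aB[symmetric] by (simp add: M)
    finally show ?thesis by (simp add: g2_def algebra_simps)
  qed
  moreover have "g1 0 = 0"
  proof -
    have "arcsin_poly' M 0 = 1"
      unfolding M arcsin_poly'_def sum.lessThan_Suc_shift by (simp add: arcsin_coeff_0)
    then show ?thesis by (simp add: g1_def M)
  qed
  ultimately have g1: "g1 \<in> O[nhds 0](\<lambda>z. z ^ Suc (2 * m + 1 + 2))"
    by (intro bigo_antiderivative[of g1 g2])
  have deriv: "((\<lambda>z. arcsin_poly M (sin z) - z + a * z ^ (2 * M + 1)) has_field_derivative g1 z) (at z)" for z
    unfolding g1_def
    by (rule derivative_eq_intros DERIV_chain2[OF arcsin_poly_deriv] refl | simp)+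
  have zero: "arcsin_poly M (sin 0) - 0 + a * 0 ^ (2 * M + 1) = 0"
    by (simp add: arcsin_poly_def)
  have "(\<lambda>z. arcsin_poly M (sin z) - z + a * z ^ (2 * M + 1)) \<in>
      O[nhds 0](\<lambda>z. z ^ Suc (Suc (2 * m + 1 + 2)))"
    by (rule bigo_antiderivative[OF deriv zero g1])
  moreover have "Suc (Suc (2 * m + 1 + 2)) = 2 * M + 3" by (simp add: M)
  ultimately show ?thesis by (simp only: a_def)
qed

section \<open>Plane waves and the dispersion relation\<close>

lemma fd_dispersion_iff:
  "fd_dispersion M h ke k \<longleftrightarrow>
     (\<exists>\<sigma>\<in>{1, -1}. arcsin_poly M (sin (k * of_real h / 2)) = \<sigma> * (1/2) * (ke * of_real h))"
proof -
  have "(\<Sum>p = 1..M. of_real (real (dfact (2 * int p - 3)) ^ 2 / fact (2 * p - 1)) * x ^ (2 * p - 1)) =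
      arcsin_poly M x" for x
    unfolding arcsin_poly_def
  proof (rule sum.reindex_bij_witness[of _ Suc "\<lambda>p. p - 1"])
    fix p assume "p \<in> {1..M}"
    then obtain q where "p = Suc q" by (cases p) auto
    then show "of_real (arcsin_coeff (p - 1)) * x ^ (2 * (p - 1) + 1) =
        of_real (real (dfact (2 * int p - 3)) ^ 2 / fact (2 * p - 1)) * x ^ (2 * p - 1)"
      by (simp add: arcsin_coeff_def)
  qed auto
  then show ?thesis unfolding fd_dispersion_def by simp
qed

text \<open>The difference of a plane wave between two points placed symmetrically about the point
  with phase \<open>a\<close>.\<close>

lemma exp_symmetric_difference:
  "exp (a + \<i> * \<phi>) - exp (a - \<i> * \<phi>) = 2 * \<i> * sin \<phi> * exp (a :: complex)"
  unfolding exp_add exp_diff by (simp add: sin_exp_eq exp_minus field_simps)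

text \<open>The two points of each difference lie symmetrically about the dual grid point
  \<open>(j + 1/2) h\<close>, at distance \<open>(2p-1) h / 2\<close>, so that each difference contributes a sine.\<close>

lemma D_primal_plane_wave:
  "D_primal M h (\<lambda>l. plane_wave h \<omega> k X l t) j =
     2 * \<i> / of_real h * arcsin_poly M (sin (k * of_real h / 2)) * X * dual_plane_wave h \<omega> k 1 j t"
proof -
  define \<theta> where "\<theta> = k * of_real h / 2"
  define a where "a = \<i> * (k * (of_int j + 1/2) * of_real h - of_real (\<omega> * t))"
  have "plane_wave h \<omega> k X (j + int p) t - plane_wave h \<omega> k X (j - int p + 1) t =
      2 * \<i> * sin ((2 * of_nat p - 1) * \<theta>) * exp a * X" for p
  proof -
    have "plane_wave h \<omega> k X (j + int p) t = X * exp (a + \<i> * ((2 * of_nat p - 1) * \<theta>))"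
      unfolding plane_wave_def
      by (intro arg_cong2[of _ _ _ _ "(*)"] arg_cong[of _ _ exp]) (simp_all add: a_def \<theta>_def field_simps)
    moreover have "plane_wave h \<omega> k X (j - int p + 1) t = X * exp (a - \<i> * ((2 * of_nat p - 1) * \<theta>))"
      unfolding plane_wave_def
      by (intro arg_cong2[of _ _ _ _ "(*)"] arg_cong[of _ _ exp]) (simp_all add: a_def \<theta>_def field_simps)
    ultimately show ?thesis
      by (simp only: right_diff_distrib[symmetric] exp_symmetric_difference mult_ac)
  qed
  then have "D_primal M h (\<lambda>l. plane_wave h \<omega> k X l t) j = 2 * \<i> / of_real h *
      (\<Sum>p = 1..M. of_real (fd_weight M p) * sin ((2 * of_nat p - 1) * \<theta>)) * X * exp a"
    unfolding D_primal_def fd_weight_def[symmetric]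
    by (simp add: sum_distrib_left sum_distrib_right mult_ac)
  then show ?thesis
    unfolding fd_symbol_eq_arcsin_poly by (simp add: \<theta>_def dual_plane_wave_def a_def)
qed

text \<open>A shift by half a cell maps the dual grid to the primal one; it only multiplies the
  amplitude by a phase.\<close>

lemma D_dual_plane_wave:
  "D_dual M h (\<lambda>l. dual_plane_wave h \<omega> k X l t) j =
     2 * \<i> / of_real h * arcsin_poly M (sin (k * of_real h / 2)) * X * plane_wave h \<omega> k 1 j t"
proof -
  define c where "c = exp (\<i> * (k * of_real h / 2))"
  have "D_dual M h H j = D_primal M h H (j - 1)" for H
    by (simp add: D_dual_def D_primal_def algebra_simps)
  moreover have "dual_plane_wave h \<omega> k X l t = plane_wave h \<omega> k (X * c) l t" for l
    by (simp add: dual_plane_wave_def plane_wave_def c_def mult.assoc flip: exp_add)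
      (simp add: algebra_simps)
  moreover have "c * dual_plane_wave h \<omega> k 1 (j - 1) t = plane_wave h \<omega> k 1 j t"
    by (simp add: dual_plane_wave_def plane_wave_def c_def flip: exp_add)
      (simp add: algebra_simps)
  ultimately show ?thesis
    by (simp add: D_primal_plane_wave mult.assoc)
qed

lemma plane_wave_scale: "plane_wave h \<omega> k X j t = X * plane_wave h \<omega> k 1 j t"
  by (simp add: plane_wave_def)

lemma plane_wave_has_vector_derivative_iff:
  "(plane_wave h \<omega> k X j has_vector_derivative Y * plane_wave h \<omega> k 1 j t) (at t) \<longleftrightarrow>
     - \<i> * of_real \<omega> * X = Y"
  and dual_plane_wave_has_vector_derivative_iff:
  "(dual_plane_wave h \<omega> k X j has_vector_derivative Y * dual_plane_wave h \<omega> k 1 j t) (at t) \<longleftrightarrow>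
     - \<i> * of_real \<omega> * X = Y"
proof -
  have *: "((\<lambda>t. X * exp (\<i> * (c - of_real (\<omega> * t)))) has_vector_derivative
      Y * exp (\<i> * (c - of_real (\<omega> * t)))) (at t) \<longleftrightarrow> - \<i> * of_real \<omega> * X = Y" (is "?L \<longleftrightarrow> _") for c :: complex
  proof -
    define e where "e = exp (\<i> * (c - of_real (\<omega> * t)))"
    have D: "((\<lambda>t. X * exp (\<i> * (c - of_real (\<omega> * t)))) has_vector_derivative
      (- \<i> * of_real \<omega> * X) * e) (at t)"
    proof -
      have "((\<lambda>z. X * exp (\<i> * (c - of_real \<omega> * z))) has_field_derivative (- \<i> * of_real \<omega> * X) * e) (at (of_real t))"
        by (auto intro!: derivative_eq_intros simp: e_def)
      from has_vector_derivative_real_field[OF this] show ?thesis by simp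
    qed
    have "?L \<longleftrightarrow> (- \<i> * of_real \<omega> * X) * e = Y * e"
      unfolding e_def[symmetric] using D vector_derivative_unique_at by metis
    also have "\<dots> \<longleftrightarrow> - \<i> * of_real \<omega> * X = Y"
      by (rule mult_right_cancel) (simp add: e_def)
    finally show ?thesis .
  qed
  show "(plane_wave h \<omega> k X j has_vector_derivative Y * plane_wave h \<omega> k 1 j t) (at t) \<longleftrightarrow>
     - \<i> * of_real \<omega> * X = Y"
    using *[of "k * of_int j * of_real h"] unfolding plane_wave_def[abs_def] by simp
  show "(dual_plane_wave h \<omega> k X j has_vector_derivative Y * dual_plane_wave h \<omega> k 1 j t) (at t) \<longleftrightarrow>
     - \<i> * of_real \<omega> * X = Y"
    using *[of "k * (of_int j + 1/2) * of_real h"] unfolding dual_plane_wave_def[abs_def] by simp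
qed

lemma fd_solution_plane_wave_iff:
  defines "S \<equiv> \<lambda>M h k. 2 * \<i> / of_real h * arcsin_poly M (sin (k * of_real h / 2))"
  shows "fd_solution M \<epsilon>\<^sub>s \<epsilon>\<^sub>i \<omega>\<^sub>1 \<gamma> h
          (dual_plane_wave h \<omega> k H0) (plane_wave h \<omega> k E0) (plane_wave h \<omega> k D0)
          (plane_wave h \<omega> k P0) (plane_wave h \<omega> k J0) \<longleftrightarrow>
     - \<i> * of_real \<omega> * H0 = S M h k * E0 \<and> - \<i> * of_real \<omega> * D0 = S M h k * H0 \<and>
     - \<i> * of_real \<omega> * P0 = J0 \<and>
     - \<i> * of_real \<omega> * J0 = - 2 * of_real \<gamma> * J0 - of_real (\<omega>\<^sub>1 ^ 2) * P0 +
        of_real ((\<epsilon>\<^sub>s - \<epsilon>\<^sub>i) * \<omega>\<^sub>1 ^ 2) * E0 \<and>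
     D0 = of_real \<epsilon>\<^sub>i * E0 + P0"
proof -
  define e where "e = plane_wave h \<omega> k 1"
  have e0: "e j t \<noteq> 0" for j t by (simp add: e_def plane_wave_def)
  have r: "- 2 * of_real \<gamma> * plane_wave h \<omega> k J0 j t - of_real (\<omega>\<^sub>1 ^ 2) * plane_wave h \<omega> k P0 j t +
        of_real ((\<epsilon>\<^sub>s - \<epsilon>\<^sub>i) * \<omega>\<^sub>1 ^ 2) * plane_wave h \<omega> k E0 j t =
      (- 2 * of_real \<gamma> * J0 - of_real (\<omega>\<^sub>1 ^ 2) * P0 + of_real ((\<epsilon>\<^sub>s - \<epsilon>\<^sub>i) * \<omega>\<^sub>1 ^ 2) * E0) *
        plane_wave h \<omega> k 1 j t" for j t
    by (simp add: plane_wave_def algebra_simps)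
  have c: "plane_wave h \<omega> k D0 j t = of_real \<epsilon>\<^sub>i * plane_wave h \<omega> k E0 j t + plane_wave h \<omega> k P0 j t \<longleftrightarrow>
      D0 = of_real \<epsilon>\<^sub>i * E0 + P0" for j t
  proof -
    have "of_real \<epsilon>\<^sub>i * plane_wave h \<omega> k E0 j t + plane_wave h \<omega> k P0 j t = (of_real \<epsilon>\<^sub>i * E0 + P0) * e j t"
      "plane_wave h \<omega> k D0 j t = D0 * e j t"
      by (simp_all add: plane_wave_def e_def algebra_simps)
    then show ?thesis using e0 by simp
  qed
  have "(plane_wave h \<omega> k P0 j has_vector_derivative plane_wave h \<omega> k J0 j t) (at t) \<longleftrightarrow>
      - \<i> * of_real \<omega> * P0 = J0" for j t
    using plane_wave_has_vector_derivative_iff[of h \<omega> k P0 j J0 t] plane_wave_scale[of h \<omega> k J0 j t] by simp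
  then show ?thesis
    unfolding fd_solution_def D_primal_plane_wave D_dual_plane_wave r c
      plane_wave_has_vector_derivative_iff dual_plane_wave_has_vector_derivative_iff S_def by simp
qed

text \<open>The Lorentz equations give \<open>P0 = (\<epsilon> - \<epsilon>\<^sub>i) E0\<close>, hence \<open>D0 = \<epsilon> E0\<close> with the permittivity \<open>\<epsilon>\<close>, and
  Maxwell's equations then give \<open>S\<^sup>2 E0 = - \<omega>\<^sup>2 \<epsilon> E0\<close>. At \<open>\<omega> = 0\<close> there are also purely magnetic solutions,
  with \<open>H0\<close> as the only nonzero amplitude; they exist when \<open>S = 0\<close>, which is the same condition.\<close>

lemma maxwell_lorentz_amplitudes:
  fixes S :: complex and \<omega> :: real
  assumes "\<epsilon>\<^sub>i \<noteq> 0" "\<omega>\<^sub>1 \<noteq> 0" and den: "lorentz_denom (\<gamma> / \<omega>\<^sub>1) (\<omega> / \<omega>\<^sub>1) \<noteq> 0"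
  shows "(\<exists>H0 E0 D0 P0 J0 :: complex. (H0, E0, D0, P0, J0) \<noteq> (0, 0, 0, 0, 0) \<and>
     - \<i> * of_real \<omega> * H0 = S * E0 \<and> - \<i> * of_real \<omega> * D0 = S * H0 \<and>
     - \<i> * of_real \<omega> * P0 = J0 \<and>
     - \<i> * of_real \<omega> * J0 = - 2 * of_real \<gamma> * J0 - of_real (\<omega>\<^sub>1 ^ 2) * P0 +
        of_real ((\<epsilon>\<^sub>s - \<epsilon>\<^sub>i) * \<omega>\<^sub>1 ^ 2) * E0 \<and>
     D0 = of_real \<epsilon>\<^sub>i * E0 + P0) \<longleftrightarrow>
   S ^ 2 = - (of_real \<omega> ^ 2 * permittivity \<epsilon>\<^sub>s \<epsilon>\<^sub>i (\<gamma> / \<omega>\<^sub>1) (\<omega> / \<omega>\<^sub>1))" (is "?L \<longleftrightarrow> ?R")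
proof -
  define d where "d = lorentz_denom (\<gamma> / \<omega>\<^sub>1) (\<omega> / \<omega>\<^sub>1)"
  define w g w1 ed ei :: complex where "w = of_real \<omega>" and "g = of_real \<gamma>" and "w1 = of_real \<omega>\<^sub>1"
    and "ed = of_real (\<epsilon>\<^sub>s - \<epsilon>\<^sub>i)" and "ei = of_real \<epsilon>\<^sub>i"
  define \<epsilon> where "\<epsilon> = permittivity \<epsilon>\<^sub>s \<epsilon>\<^sub>i (\<gamma> / \<omega>\<^sub>1) (\<omega> / \<omega>\<^sub>1)"
  have d0: "d \<noteq> 0" "w1 \<noteq> 0" "ei \<noteq> 0" using assms by (simp_all add: d_def w1_def ei_def)
  have dw: "w1 ^ 2 * d = w ^ 2 + 2 * \<i> * g * w - w1 ^ 2"
    using d0(2) unfolding d_def lorentz_denom_def w_def g_def w1_def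
    by (simp add: field_simps power2_eq_square)
  have \<epsilon>: "\<epsilon> = ei - ed / d"
    using d0 unfolding \<epsilon>_def permittivity_def d_def[symmetric] ed_def ei_def
    by (simp add: field_simps)
  \<comment> \<open>After elimination of \<open>J0\<close>, both sides of the equation for \<open>P0\<close> have the factor \<open>w1\<^sup>2\<close>.\<close>
  have polarization: "- \<i> * w * (- \<i> * w * P0) = - 2 * g * (- \<i> * w * P0) - w1 ^ 2 * P0 + ed * w1 ^ 2 * E0 \<longleftrightarrow>
      d * P0 = - ed * E0" for P0 E0
  proof -
    have "- \<i> * w * (- \<i> * w * P0) = - (w ^ 2 * P0)"
      by (simp add: power2_eq_square algebra_simps)
    then have "- \<i> * w * (- \<i> * w * P0) = - 2 * g * (- \<i> * w * P0) - w1 ^ 2 * P0 + ed * w1 ^ 2 * E0 \<longleftrightarrow>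
      (w ^ 2 + 2 * \<i> * g * w - w1 ^ 2) * P0 = w1 ^ 2 * (- ed * E0)"
      by (auto simp: algebra_simps)
    also have "\<dots> \<longleftrightarrow> d * P0 = - ed * E0"
      unfolding dw[symmetric] unfolding mult.assoc mult_cancel_left using d0(2) by simp
    finally show ?thesis .
  qed
  have "?L \<longleftrightarrow> (\<exists>H0 E0 D0 P0 J0. (H0, E0, D0, P0, J0) \<noteq> (0, 0, 0, 0, 0) \<and>
     - \<i> * w * H0 = S * E0 \<and> - \<i> * w * D0 = S * H0 \<and> - \<i> * w * P0 = J0 \<and>
     d * P0 = - ed * E0 \<and> D0 = ei * E0 + P0)"
    unfolding polarization[symmetric] by (auto simp: w_def g_def w1_def ed_def ei_def)
  also have "\<dots> \<longleftrightarrow> S ^ 2 = - (w ^ 2 * \<epsilon>)" (is "?A \<longleftrightarrow> _")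
  proof
    assume ?A
    then obtain H0 E0 D0 P0 J0 where nz: "(H0, E0, D0, P0, J0) \<noteq> (0, 0, 0, 0, 0)"
      and H: "- \<i> * w * H0 = S * E0" and D: "- \<i> * w * D0 = S * H0" and J: "- \<i> * w * P0 = J0"
      and P: "d * P0 = - ed * E0" and C: "D0 = ei * E0 + P0" by blast
    show "S ^ 2 = - (w ^ 2 * \<epsilon>)"
    proof (cases "E0 = 0")
      case True
      with P d0 have "P0 = 0" by simp
      with J C True have "J0 = 0" "D0 = 0" by auto
      with nz True \<open>P0 = 0\<close> have "H0 \<noteq> 0" by simp
      with H D True \<open>D0 = 0\<close> have "w = 0" "S = 0" by auto
      then show ?thesis by simp
    next
      case False
      have "P0 = - ed * E0 / d" using P d0 by (simp add: field_simps)
      then have "D0 = \<epsilon> * E0" unfolding C \<epsilon> by (simp add: algebra_simps)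
      have "S ^ 2 * E0 = S * (- \<i> * w * H0)" unfolding H by (simp add: power2_eq_square)
      also have "\<dots> = - \<i> * w * (S * H0)" by simp
      also have "\<dots> = - (w ^ 2 * \<epsilon>) * E0"
        unfolding D[symmetric] \<open>D0 = \<epsilon> * E0\<close> by (simp add: power2_eq_square algebra_simps)
      finally show ?thesis using mult_right_cancel[OF False] by blast
    qed
  next
    assume S: "S ^ 2 = - (w ^ 2 * \<epsilon>)"
    show ?A
    proof (cases "w = 0")
      case True
      with S have "S = 0" by simp
      with True show ?thesis
        by (intro exI[of _ 1] exI[of _ 0]) auto
    next
      case False
      have "- \<i> * w * \<epsilon> = S * (\<i> * S / w)"
        using False S by (simp add: field_simps power2_eq_square)
      then show ?thesis
        using False d0
        by (intro exI[of _ "\<i> * S / w"] exI[of _ 1] exI[of _ \<epsilon>] exI[of _ "- ed / d"]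
            exI[of _ "- \<i> * w * (- ed / d)"]) (auto simp: \<epsilon>)
    qed
  qed
  finally show ?thesis by (simp add: w_def \<epsilon>_def)
qed

lemma fd_wave_number_iff_dispersion:
  assumes "\<epsilon>\<^sub>i \<noteq> 0" "\<omega>\<^sub>1 \<noteq> 0" "h \<noteq> 0" "lorentz_denom (\<gamma> / \<omega>\<^sub>1) (\<omega> / \<omega>\<^sub>1) \<noteq> 0"
  shows "fd_wave_number M \<epsilon>\<^sub>s \<epsilon>\<^sub>i \<omega>\<^sub>1 \<gamma> h \<omega> k \<longleftrightarrow> fd_dispersion M h (k_ex \<epsilon>\<^sub>s \<epsilon>\<^sub>i \<omega>\<^sub>1 \<gamma> \<omega>) k"
proof -
  define A where "A = arcsin_poly M (sin (k * of_real h / 2))"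
  define \<kappa> where "\<kappa> = k_ex \<epsilon>\<^sub>s \<epsilon>\<^sub>i \<omega>\<^sub>1 \<gamma> \<omega>"
  have "\<kappa> ^ 2 = of_real \<omega> ^ 2 * permittivity \<epsilon>\<^sub>s \<epsilon>\<^sub>i (\<gamma> / \<omega>\<^sub>1) (\<omega> / \<omega>\<^sub>1)"
    by (simp add: \<kappa>_def k_ex_def power_mult_distrib)
  then have "fd_wave_number M \<epsilon>\<^sub>s \<epsilon>\<^sub>i \<omega>\<^sub>1 \<gamma> h \<omega> k \<longleftrightarrow> (2 * \<i> / of_real h * A) ^ 2 = - (\<kappa> ^ 2)"
    unfolding fd_wave_number_def fd_solution_plane_wave_iff
      maxwell_lorentz_amplitudes[OF assms(1,2,4)] A_def by simp
  also have "(2 * \<i> / of_real h * A) ^ 2 = - ((2 * A / of_real h) ^ 2)"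
    by (simp add: power_mult_distrib power_divide)
  also have "- ((2 * A / of_real h) ^ 2) = - (\<kappa> ^ 2) \<longleftrightarrow> 2 * A / of_real h = \<kappa> \<or> 2 * A / of_real h = - \<kappa>"
    unfolding neg_equal_iff_equal by (rule power2_eq_iff)
  also have "\<dots> \<longleftrightarrow> A = 1 * (1/2) * (\<kappa> * of_real h) \<or> A = - 1 * (1/2) * (\<kappa> * of_real h)"
    using assms(3) by (simp add: field_simps)
  finally show ?thesis
    unfolding fd_dispersion_iff A_def[symmetric] \<kappa>_def[symmetric] by blast
qed

section \<open>The dispersion error\<close>

text \<open>A crude form of \<open>arcsin_poly_sin_bigo\<close>, sufficient to determine the sign in the dispersion
  relation.\<close>

lemma arcsin_poly_sin_minus_id_bigo:
  assumes "M \<ge> 1"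
  shows "(\<lambda>z. arcsin_poly M (sin z) - z) \<in> O[nhds 0](\<lambda>z. z ^ 2)"
proof -
  have ev: "\<forall>\<^sub>F z in nhds 0. norm (z :: complex) \<le> 1"
    unfolding eventually_nhds_metric by (auto intro!: exI[of _ 1])
  have pow: "(\<lambda>z::complex. z ^ n) \<in> O[nhds 0](\<lambda>z. z ^ 2)" if "n \<ge> 2" for n
  proof (rule landau_o.bigI[of 1])
    show "\<forall>\<^sub>F z in nhds 0. norm ((z :: complex) ^ n) \<le> 1 * norm (z ^ 2)"
      using ev by eventually_elim (use that in \<open>auto simp: norm_power intro: power_decreasing\<close>)
  qed simp
  have "(\<lambda>z. (arcsin_poly M (sin z) - z + of_real (arcsin_coeff M) * z ^ (2 * M + 1)) -
      of_real (arcsin_coeff M) * z ^ (2 * M + 1)) \<in> O[nhds 0](\<lambda>z. z ^ 2)"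
  proof (rule sum_in_bigo)
    show "(\<lambda>z. arcsin_poly M (sin z) - z + of_real (arcsin_coeff M) * z ^ (2 * M + 1)) \<in> O[nhds 0](\<lambda>z. z ^ 2)"
      by (rule landau_o.big.trans[OF arcsin_poly_sin_bigo[OF assms] pow]) simp
    show "(\<lambda>z::complex. of_real (arcsin_coeff M) * z ^ (2 * M + 1)) \<in> O[nhds 0](\<lambda>z. z ^ 2)"
      using pow[of "2 * M + 1"] assms arcsin_coeff_pos[of M] by simp
  qed
  then show ?thesis by simp
qed

text \<open>The parameters at which \<open>K\<close> vanishes need a separate hypothesis: along a general filter
  they may occur arbitrarily late, and there the first bound says nothing about \<open>u\<close>.\<close>

lemma bigo_cancel_left:
  fixes K u v :: "'t \<Rightarrow> complex"
  assumes "(\<lambda>t. K t * u t) \<in> O[F](\<lambda>t. K t * v t)" and "\<forall>\<^sub>F t in F. K t = 0 \<longrightarrow> u t = 0"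
  shows "u \<in> O[F](v)"
proof -
  from assms(1) obtain C where C: "C > 0" "\<forall>\<^sub>F t in F. norm (K t * u t) \<le> C * norm (K t * v t)"
    by (elim landau_o.bigE)
  have "\<forall>\<^sub>F t in F. norm (u t) \<le> C * norm (v t)"
    using C(2) assms(2)
  proof eventually_elim
    case (elim t)
    show ?case
    proof (cases "K t = 0")
      case True
      then show ?thesis using elim C(1) by simp
    next
      case False
      have "norm (K t) * norm (u t) \<le> norm (K t) * (C * norm (v t))"
        using elim by (simp add: norm_mult mult_ac)
      then show ?thesis using False by simp
    qed
  qed
  then show ?thesis by (rule landau_o.bigI[OF C(1)])
qed

lemma tendsto_imp_bigo_1:
  fixes f :: "'t \<Rightarrow> complex"
  assumes "(f \<longlongrightarrow> c) F"
  shows "f \<in> O[F](\<lambda>_. 1)"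
  using assms by (intro bigoI_tendsto[where c = c]) auto

text \<open>The relation for \<open>\<delta>\<close> is implicit, since its leading term \<open>X\<close> contains \<open>(1 + \<delta>)\<^sup>2\<^sup>M\<^sup>+\<^sup>1\<close>. It is used
  twice: it bounds \<open>\<delta>\<close> by \<open>K\<^sup>2\<^sup>M\<close>, and with that bound \<open>X\<close> may be replaced by its value at \<open>\<delta> = 0\<close>, at the cost
  of a term \<open>O(K\<^sup>4\<^sup>M)\<close>.\<close>

lemma dispersion_error_bigo:
  fixes K \<delta> :: "'t \<Rightarrow> complex"
  assumes M: "M \<ge> 1"
    and K: "(K \<longlongrightarrow> 0) F" and \<delta>: "(\<delta> \<longlongrightarrow> 0) F"
    and vanish: "\<forall>\<^sub>F t in F. K t = 0 \<longrightarrow> \<delta> t = 0"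
    and disp: "\<forall>\<^sub>F t in F. \<exists>s\<in>{1, -1}. arcsin_poly M (sin (K t * (1 + \<delta> t) / 2)) = s * (K t / 2)"
  shows "(\<lambda>t. \<delta> t - of_real (arcsin_coeff M / 2 ^ (2 * M)) * K t ^ (2 * M)) \<in> O[F](\<lambda>t. K t ^ (2 * M + 2))"
proof -
  define f where "f z = arcsin_poly M (sin z)" for z
  define \<theta> where "\<theta> t = K t * (1 + \<delta> t) / 2" for t
  define a :: complex where "a = of_real (arcsin_coeff M)"
  define n where "n = 2 * M + 1"
  define X where "X t = a / 2 ^ (2 * M) * K t ^ (2 * M) * (1 + \<delta> t) ^ n" for t
  have one_\<delta>: "((\<lambda>t. 1 + \<delta> t) \<longlongrightarrow> 1) F"
    using tendsto_add[OF tendsto_const \<delta>] by simp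
  \<comment> \<open>\<open>\<theta>\<close> tends to \<open>0\<close> and is of the order of \<open>K\<close>, so the expansions at \<open>0\<close> can be composed with it.\<close>
  have \<theta>0: "filterlim \<theta> (nhds 0) F"
    using tendsto_mult[OF K one_\<delta>] unfolding \<theta>_def by (auto intro: tendsto_divide_zero)
  have "(\<lambda>t. K t * ((1 + \<delta> t) / 2)) \<in> O[F](\<lambda>t. K t * 1)"
    by (intro landau_o.big.mult landau_o.big_refl tendsto_imp_bigo_1[OF tendsto_divide[OF one_\<delta> tendsto_const]]) simp
  then have \<theta>K: "\<theta> \<in> O[F](K)"
    unfolding \<theta>_def[abs_def] by simp
  have powers: "(\<lambda>t. K t ^ i) \<in> O[F](\<lambda>t. K t ^ j)" if "j \<le> i" for i j
  proof -
    have "(\<lambda>t. K t ^ (i - j) * K t ^ j) \<in> O[F](\<lambda>t. 1 * K t ^ j)"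
      by (intro landau_o.big.mult landau_o.big_refl tendsto_imp_bigo_1[OF tendsto_power[OF K]])
    then show ?thesis using that by (simp flip: power_add)
  qed
  have f2: "(\<lambda>t. f (\<theta> t) - \<theta> t) \<in> O[F](\<lambda>t. K t * K t)"
  proof -
    have "(\<lambda>t. f (\<theta> t) - \<theta> t) \<in> O[F](\<lambda>t. \<theta> t ^ 2)"
      unfolding f_def by (rule landau_o.big.compose[OF arcsin_poly_sin_minus_id_bigo[OF M] \<theta>0])
    also have "(\<lambda>t. \<theta> t ^ 2) \<in> O[F](\<lambda>t. K t ^ 2)"
      by (rule landau_o.big_power[OF \<theta>K])
    finally show ?thesis by (simp add: power2_eq_square)
  qed
  have "(\<lambda>t. K t * K t) \<in> o[F](\<lambda>t. 1 * K t)"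
    by (intro landau_o.small_big_mult landau_o.big_refl smalloI_tendsto) (simp_all add: K)
  \<comment> \<open>With the opposite sign, \<open>f \<theta> - \<theta> = - K (2 + \<delta>) / 2\<close> would have norm at least \<open>norm K / 2\<close>,
    which exceeds the bound \<open>norm K / 4\<close> unless \<open>K = 0\<close>; in that case the signs agree anyway.\<close>
  with f2 have "(\<lambda>t. f (\<theta> t) - \<theta> t) \<in> o[F](K)"
    by (simp add: landau_o.big_small_trans)
  then have small: "\<forall>\<^sub>F t in F. norm (f (\<theta> t) - \<theta> t) \<le> 1/4 * norm (K t)"
    by (rule landau_o.smallD) simp
  have "\<forall>\<^sub>F t in F. norm (\<delta> t) < 1"
    using tendstoD[OF \<delta>, of 1] by simp
  with small disp have sign: "\<forall>\<^sub>F t in F. f (\<theta> t) = K t / 2"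
  proof eventually_elim
    case (elim t)
    have "K t = 0" if "f (\<theta> t) = - (K t / 2)"
    proof -
      have "f (\<theta> t) - \<theta> t = - (K t * (2 + \<delta> t) / 2)"
        unfolding that unfolding \<theta>_def by (simp add: field_simps)
      then have "norm (K t) * norm (2 + \<delta> t) / 2 \<le> 1/4 * norm (K t)"
        using elim(1) by (simp add: norm_mult norm_divide)
      moreover have "norm (2 + \<delta> t) \<ge> 1"
        using norm_diff_ineq[of 2 "\<delta> t"] elim(3) by simp
      then have "norm (K t) * norm (2 + \<delta> t) \<ge> norm (K t) * 1"
        by (intro mult_left_mono) auto
      ultimately have "norm (K t) \<le> 0" by linarith
      then show ?thesis by simp
    qed
    moreover obtain s where s: "s \<in> {1, -1}" "f (\<theta> t) = s * (K t / 2)"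
      using elim(2) unfolding f_def \<theta>_def by blast
    moreover have "f (\<theta> t) = K t / 2 \<or> f (\<theta> t) = - (K t / 2)"
      unfolding s(2) using s(1) by auto
    ultimately show ?case by fastforce
  qed
  have "(\<lambda>t. f (\<theta> t) - \<theta> t + a * \<theta> t ^ n) \<in> O[F](\<lambda>t. \<theta> t ^ (2 * M + 3))"
    unfolding f_def n_def a_def by (rule landau_o.big.compose[OF arcsin_poly_sin_bigo[OF M] \<theta>0])
  also have "(\<lambda>t. \<theta> t ^ (2 * M + 3)) \<in> O[F](\<lambda>t. K t ^ (2 * M + 3))"
    by (rule landau_o.big_power[OF \<theta>K])
  finally have "(\<lambda>t. - 2 * (f (\<theta> t) - \<theta> t + a * \<theta> t ^ n)) \<in> O[F](\<lambda>t. K t ^ (2 * M + 3))"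
    by (subst landau_o.big.cmult_in_iff) simp_all
  also have "?this \<longleftrightarrow> (\<lambda>t. K t * (\<delta> t - X t)) \<in>
      O[F](\<lambda>t. K t * K t ^ (2 * M + 2))"
  proof (rule landau_o.big.cong_ex)
    show "\<forall>\<^sub>F t in F. - 2 * (f (\<theta> t) - \<theta> t + a * \<theta> t ^ n) =
        K t * (\<delta> t - X t)"
      using sign
    proof eventually_elim
      case (elim t)
      have X: "a * \<theta> t ^ n = K t * X t / 2"
        by (simp add: X_def \<theta>_def n_def power_mult_distrib power_divide mult_ac)
      show ?case unfolding elim X by (simp add: \<theta>_def field_simps)
    qed
    have "2 * M + 3 = Suc (2 * M + 2)" by simp
    then show "\<forall>\<^sub>F t in F. K t ^ (2 * M + 3) = K t * K t ^ (2 * M + 2)"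
      by (simp only: power_Suc) simp
  qed
  finally have implicit: "(\<lambda>t. \<delta> t - X t) \<in> O[F](\<lambda>t. K t ^ (2 * M + 2))"
  proof (rule bigo_cancel_left)
    show "\<forall>\<^sub>F t in F. K t = 0 \<longrightarrow> \<delta> t - X t = 0"
      using vanish by eventually_elim (use M in \<open>auto simp: X_def\<close>)
  qed
  have "(\<lambda>t. X t) \<in> O[F](\<lambda>t. 1 * K t ^ (2 * M) * 1)"
    unfolding X_def
    by (intro landau_o.big.mult landau_o.big_refl tendsto_imp_bigo_1[OF tendsto_const]
        tendsto_imp_bigo_1[OF tendsto_power[OF one_\<delta>]])
  then have "X \<in> O[F](\<lambda>t. K t ^ (2 * M))" by simp
  from sum_in_bigo(1)[OF landau_o.big_trans[OF implicit powers] this]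
  have "(\<lambda>t. (\<delta> t - X t) + X t) \<in> O[F](\<lambda>t. K t ^ (2 * M))" by simp
  then have \<delta>_big: "\<delta> \<in> O[F](\<lambda>t. K t ^ (2 * M))" by simp
  \<comment> \<open>The sum is the quotient \<open>((1 + \<delta>)\<^sup>n - 1) / \<delta>\<close>.\<close>
  have "(\<lambda>t. a / 2 ^ (2 * M) * K t ^ (2 * M) * (\<delta> t * (\<Sum>i<n. (1 + \<delta> t) ^ i))) \<in>
      O[F](\<lambda>t. 1 * K t ^ (2 * M) * (K t ^ (2 * M) * 1))"
    by (intro landau_o.big.mult landau_o.big_refl \<delta>_big tendsto_imp_bigo_1[OF tendsto_const]
        tendsto_imp_bigo_1[OF tendsto_sum[OF tendsto_power[OF one_\<delta>]]])
  also have "(\<lambda>t. 1 * K t ^ (2 * M) * (K t ^ (2 * M) * 1)) = (\<lambda>t. K t ^ (2 * M + 2 * M))"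
    by (simp only: power_add mult_1_left mult_1_right)
  also have "(\<lambda>t. K t ^ (2 * M + 2 * M)) \<in> O[F](\<lambda>t. K t ^ (2 * M + 2))"
    using M by (intro powers) simp
  also have "(\<lambda>t. a / 2 ^ (2 * M) * K t ^ (2 * M) * (\<delta> t * (\<Sum>i<n. (1 + \<delta> t) ^ i))) =
      (\<lambda>t. X t - a / 2 ^ (2 * M) * K t ^ (2 * M))"
  proof
    fix t
    have "\<delta> t * (\<Sum>i<n. (1 + \<delta> t) ^ i) = (1 + \<delta> t) ^ n - 1"
      using power_diff_1_eq[of "1 + \<delta> t" n] by simp
    then show "a / 2 ^ (2 * M) * K t ^ (2 * M) * (\<delta> t * (\<Sum>i<n. (1 + \<delta> t) ^ i)) =
        X t - a / 2 ^ (2 * M) * K t ^ (2 * M)"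
      by (simp add: X_def right_diff_distrib)
  qed
  finally have "(\<lambda>t. (\<delta> t - X t) + (X t - a / 2 ^ (2 * M) * K t ^ (2 * M))) \<in> O[F](\<lambda>t. K t ^ (2 * M + 2))"
    by (intro sum_in_bigo(1)[OF implicit])
  then show ?thesis by (simp add: a_def)
qed

text \<open>The relative deviation \<open>\<delta>\<close> that comes with a physical mode is itself the error \<open>\<zeta>\<close>. Its
  a priori bound by \<open>norm K powr \<tau>\<close> yields \<open>\<delta> \<rightarrow> 0\<close>, and also \<open>\<delta> = 0\<close> wherever \<open>K = 0\<close>, because
  \<open>0 powr \<tau> = 0\<close>. As \<open>T \<circ> sin\<close> is odd, the sign \<open>\<sigma>\<close> of the mode can be absorbed into the sign of the dispersion
  relation.\<close>

lemma physical_mode_error: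
  fixes K :: "'t \<Rightarrow> complex"
  assumes M: "M \<ge> 1" and K_def: "K = (\<lambda>t. ke t * of_real (h t))"
    and K: "(K \<longlongrightarrow> 0) F" and \<sigma>: "\<sigma> \<in> {1, -1}" and mode: "physical_mode M F h ke \<sigma> k"
  shows "\<exists>\<zeta>. (\<forall>\<^sub>F t in F. k t = \<sigma> * ke t * (1 + \<zeta> t)) \<and>
     (\<lambda>t. \<zeta> t - of_real (arcsin_coeff M / 2 ^ (2 * M)) * K t ^ (2 * M)) \<in> O[F](\<lambda>t. K t ^ (2 * M + 2)) \<and>
     \<zeta> \<in> \<Theta>[F](\<lambda>t. K t ^ (2 * M))"
proof -
  from mode obtain \<tau> \<delta> where disp: "\<forall>\<^sub>F t in F. fd_dispersion M (h t) (ke t) (k t)"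
    and "\<tau> > 0" and k: "\<forall>\<^sub>F t in F. k t = \<sigma> * ke t * (1 + \<delta> t)"
    and \<delta>: "(\<lambda>t. norm (\<delta> t)) \<in> O[F](\<lambda>t. norm (K t) powr \<tau>)"
    unfolding physical_mode_def K_def by blast
  from \<delta> obtain C where C: "C > 0" "\<forall>\<^sub>F t in F. norm (\<delta> t) \<le> C * norm (K t) powr \<tau>"
    by (elim landau_o.bigE) simp
  have "((\<lambda>t. C * norm (K t) powr \<tau>) \<longlongrightarrow> C * 0 powr \<tau>) F"
    using K \<open>\<tau> > 0\<close> by (intro tendsto_mult_left tendsto_powr') (auto intro: tendsto_norm_zero)
  then have "((\<lambda>t. C * norm (K t) powr \<tau>) \<longlongrightarrow> 0) F" by simp
  with C(2) have \<delta>0: "(\<delta> \<longlongrightarrow> 0) F" by (rule Lim_null_comparison)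
  have vanish: "\<forall>\<^sub>F t in F. K t = 0 \<longrightarrow> \<delta> t = 0"
    using C(2) by eventually_elim auto
  have "\<forall>\<^sub>F t in F. \<exists>s\<in>{1, -1}. arcsin_poly M (sin (K t * (1 + \<delta> t) / 2)) = s * (K t / 2)"
    using disp k
  proof eventually_elim
    case (elim t)
    define \<theta> where "\<theta> = K t * (1 + \<delta> t) / 2"
    have half: "k t * of_real (h t) / 2 = \<sigma> * \<theta>"
      unfolding elim(2) \<theta>_def K_def by simp
    obtain s where "s \<in> {1, -1}"
      "arcsin_poly M (sin (k t * of_real (h t) / 2)) = s * (1/2) * (ke t * of_real (h t))"
      using elim(1) unfolding fd_dispersion_iff by blast
    then have s: "s \<in> {1, -1}" "arcsin_poly M (sin (\<sigma> * \<theta>)) = s * (K t / 2)"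
      unfolding half K_def by simp_all
    have odd: "arcsin_poly M (sin (\<sigma> * \<theta>)) = \<sigma> * arcsin_poly M (sin \<theta>)"
      using \<sigma> by (auto simp: arcsin_poly_def sum_negf)
    have "arcsin_poly M (sin \<theta>) = \<sigma> * (\<sigma> * arcsin_poly M (sin \<theta>))"
      using \<sigma> by auto
    also have "\<dots> = \<sigma> * s * (K t / 2)"
      unfolding odd[symmetric] s(2) by (simp only: mult.assoc)
    finally have "arcsin_poly M (sin \<theta>) = \<sigma> * s * (K t / 2)" .
    moreover have "\<sigma> * s \<in> {1, -1}" using \<sigma> s(1) by auto
    ultimately show ?case unfolding \<theta>_def[symmetric] by blast
  qed
  from dispersion_error_bigo[OF M K \<delta>0 vanish this]
  have err: "(\<lambda>t. \<delta> t - of_real (arcsin_coeff M / 2 ^ (2 * M)) * K t ^ (2 * M)) \<in> O[F](\<lambda>t. K t ^ (2 * M + 2))" .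
  define c :: complex where "c = of_real (arcsin_coeff M / 2 ^ (2 * M))"
  have c: "c \<noteq> 0" using arcsin_coeff_pos[of M] by (simp add: c_def)
  have "(\<lambda>t. K t ^ 2 * K t ^ (2 * M)) \<in> o[F](\<lambda>t. 1 * K t ^ (2 * M))"
    using tendsto_power[OF K, of 2] by (intro landau_o.small_big_mult landau_o.big_refl smalloI_tendsto) simp_all
  then have "(\<lambda>t. K t ^ (2 * M + 2)) \<in> o[F](\<lambda>t. K t ^ (2 * M))"
    by (simp add: power_add power2_eq_square mult_ac)
  with err c have "(\<lambda>t. \<delta> t - c * K t ^ (2 * M)) \<in> o[F](\<lambda>t. c * K t ^ (2 * M))"
    unfolding c_def[symmetric] by (simp add: landau_o.big_small_trans)
  from landau_theta.plus_absorb2[OF this]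
  have "\<Theta>[F](\<delta>) = \<Theta>[F](\<lambda>t. K t ^ (2 * M))" using c by simp
  then have "\<delta> \<in> \<Theta>[F](\<lambda>t. K t ^ (2 * M))"
    using bigthetaI[OF landau_o.big_refl landau_omega.big_refl, of \<delta> F] by (simp only:)
  with k err show ?thesis by (intro exI[of _ \<delta>] conjI)
qed

theorem theorem5p1:
  fixes M :: nat and \<epsilon>\<^sub>s \<epsilon>\<^sub>i \<omega>\<^sub>1 \<gamma> :: real
  assumes "M \<ge> 1" and "0 < \<epsilon>\<^sub>i" and "\<epsilon>\<^sub>i < \<epsilon>\<^sub>s" and "0 < \<omega>\<^sub>1" and "0 \<le> \<gamma>"
  shows
    "(\<forall>(h::real) (\<omega>::real) (k::complex).
        0 < h \<longrightarrow> 0 \<le> \<omega> \<longrightarrow> lorentz_denom (\<gamma> / \<omega>\<^sub>1) (\<omega> / \<omega>\<^sub>1) \<noteq> 0 \<longrightarrow>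
        (fd_wave_number M \<epsilon>\<^sub>s \<epsilon>\<^sub>i \<omega>\<^sub>1 \<gamma> h \<omega> k \<longleftrightarrow>
         fd_dispersion M h (k_ex \<epsilon>\<^sub>s \<epsilon>\<^sub>i \<omega>\<^sub>1 \<gamma> \<omega>) k))
     \<and>
     (\<forall>(F::'t filter) (h::'t \<Rightarrow> real) (\<omega>::'t \<Rightarrow> real) (ke::'t \<Rightarrow> complex) (K::'t \<Rightarrow> complex)
        (k::'t \<Rightarrow> complex) (\<sigma>::complex).
        (\<forall>\<^sub>F t in F. 0 < h t \<and> 0 \<le> \<omega> t \<and> lorentz_denom (\<gamma> / \<omega>\<^sub>1) (\<omega> t / \<omega>\<^sub>1) \<noteq> 0) \<longrightarrow>
        ke = (\<lambda>t. k_ex \<epsilon>\<^sub>s \<epsilon>\<^sub>i \<omega>\<^sub>1 \<gamma> (\<omega> t)) \<longrightarrow>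
        K = (\<lambda>t. ke t * of_real (h t)) \<longrightarrow>
        (K \<longlongrightarrow> 0) F \<longrightarrow>
        \<sigma> \<in> {1, -1} \<longrightarrow>
        physical_mode M F h ke \<sigma> k \<longrightarrow>
        (\<exists>\<zeta>::'t \<Rightarrow> complex.
           (\<forall>\<^sub>F t in F. k t = \<sigma> * ke t * (1 + \<zeta> t)) \<and>
           (\<lambda>t. \<zeta> t - of_real (real (dfact (2 * int M - 1)) ^ 2 / (2 ^ (2 * M) * fact (2 * M + 1)))
                        * K t ^ (2 * M)) \<in> O[F](\<lambda>t. K t ^ (2 * M + 2)) \<and>
           \<zeta> \<in> \<Theta>[F](\<lambda>t. K t ^ (2 * M))))"
proof (intro conjI allI impI)
  fix h \<omega> :: real and k :: complex
  assume "0 < h" "lorentz_denom (\<gamma> / \<omega>\<^sub>1) (\<omega> / \<omega>\<^sub>1) \<noteq> 0"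
  then show "fd_wave_number M \<epsilon>\<^sub>s \<epsilon>\<^sub>i \<omega>\<^sub>1 \<gamma> h \<omega> k \<longleftrightarrow> fd_dispersion M h (k_ex \<epsilon>\<^sub>s \<epsilon>\<^sub>i \<omega>\<^sub>1 \<gamma> \<omega>) k"
    using assms by (intro fd_wave_number_iff_dispersion) auto
next
  fix F :: "'t filter" and h \<omega> :: "'t \<Rightarrow> real" and ke K k :: "'t \<Rightarrow> complex" and \<sigma> :: complex
  assume "\<forall>\<^sub>F t in F. 0 < h t \<and> 0 \<le> \<omega> t \<and> lorentz_denom (\<gamma> / \<omega>\<^sub>1) (\<omega> t / \<omega>\<^sub>1) \<noteq> 0"
    and K: "K = (\<lambda>t. ke t * of_real (h t))" "(K \<longlongrightarrow> 0) F" "\<sigma> \<in> {1, -1}" "physical_mode M F h ke \<sigma> k"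
  have "arcsin_coeff M / 2 ^ (2 * M) = real (dfact (2 * int M - 1)) ^ 2 / (2 ^ (2 * M) * fact (2 * M + 1))"
    by (simp add: arcsin_coeff_def mult.commute del: fact_Suc)
  from physical_mode_error[OF assms(1) K, unfolded this]
  show "\<exists>\<zeta>. (\<forall>\<^sub>F t in F. k t = \<sigma> * ke t * (1 + \<zeta> t)) \<and>
      (\<lambda>t. \<zeta> t - of_real (real (dfact (2 * int M - 1)) ^ 2 / (2 ^ (2 * M) * fact (2 * M + 1))) * K t ^ (2 * M))
        \<in> O[F](\<lambda>t. K t ^ (2 * M + 2)) \<and>
      \<zeta> \<in> \<Theta>[F](\<lambda>t. K t ^ (2 * M))" .
qed

end
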